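(* Let $X=(X_n)_{n\ge 0}$ be a stochastic process with values in $\mathbb{Z}_+=\{0,1,2,\dots\}$ (or in $\{0,\dots,\widetilde N\}$ for some finite $\widetilde N\in\mathbb{N}$), let $N\ge 0$ be an integer, and let $(\kappa_m)_{m\ge 0}$ be a non-decreasing sequence of numbers in $(0,1]$. Let $\mathcal{F}_n$ be the natural filtration of $X$ and let $\widetilde{\mathcal{F}}_n\subset\mathcal{F}_n$ be the $\sigma$-algebra generated by the current strictly decreasing stretch of the trajectory ending at time $n$ (defined in the context). Assume: (A1) (random memory depth) for every $n\ge 0$ and every state $j$, $\mathsf{P}(X_{n+1}=j\mid\mathcal{F}_n)=\mathsf{P}(X_{n+1}=j\mid\widetilde{\mathcal{F}}_n)$ a.s.; (A3) (recurrence-1) for every $m\ge 1$ and every $n\ge m-1$, a.s. on the event $\{N<X_n<X_{n-1}<\dots<X_{n-m+1}\}$ (which for $m=1$ is $\{N<X_n\}$), $$\mathsf{P}(X_{n+1}<X_n\mid\widetilde{\mathcal{F}}_n)\ \ge\ \kappa_{m-1}>0;$$ (A4) (recurrence-2) $\kappa_m\to 1$ as $m\to\infty$ with exponential rate, i.e. there are $C,\lambda>0$ with $1-\kappa_m\le Ce^{-\lambda m}$ for all $m\ge 0$, and $\prod_{i=0}^{\infty}\kappa_i>0$; (A5) (exponential moment of upward jumps) for all sufficiently small $\alpha>0$, $$M_\alpha:=\operatorname*{ess\,sup}_{\omega}\ \sup_{n\ge 0}\ \mathsf{E}\bigl(e^{\alpha (X_{n+1}-X_n)_+}\mid\widetilde{\mathcal{F}}_n\bigr)<\infty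 .$$ Let $\tau:=\inf\{t\ge 0: X_t\le N\}$. Then for all sufficiently small $\alpha>0$ there exists a constant $C_1>0$ such that for every initial state $v_0$, $$\mathsf{E}_{v_0}e^{\alpha\tau}\ \le\ C_1\,e^{\alpha v_0}.$$
   Context: For $n\ge 0$ define the start of the current strictly decreasing stretch $$\zeta_n:=\inf\{0\le k\le n:\ X_{i+1}-X_i<0\ \text{ for all } i=k,\dots,n-1\}$$ (for $k=n$ the condition is vacuous, so $\zeta_n\le n$ is always well defined). Set $\hat X_{i,n}:=X_i\,\mathbf{1}(\zeta_n\le i\le n)$ and $$\widetilde{\mathcal{F}}_n:=\sigma\bigl(\zeta_n;\ \hat X_{i,n}:\ 0\le i\le n\bigr).$$ Thus $\widetilde{\mathcal{F}}_n$ records $\zeta_n, X_{\zeta_n},\dots,X_n$; the family $(\widetilde{\mathcal{F}}_n)$ is not a filtration in general. $\mathcal{F}_n=\sigma(X_0,\dots,X_n)$ is the natural filtration. All relations between conditional probabilities and conditional expectations are understood almost surely. Notation: $a_+=\max(a,0)$; $\mathsf{P}_{v_0}(\cdot)=\mathsf{P}(\cdot\mid X_0=v_0)$ and $\mathsf{E}_{v_0}$ is the corresponding expectation, where $v_0$ ranges over the states with $\mathsf{P}(X_0=v_0)>0$. The infimum of the empty set in the definition of $\tau$ is $+\infty$, with $e^{\alpha\cdot\infty}=+\infty$. The integer $N$ in the definition of $\tau$ is the same as in (A3). The constant $C_1$ may depend on $\alpha$ but not on $v_0$. *)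

theory Defs
  imports "HOL-Probability.Probability"
begin

definition sigma_generated :: "'a measure \<Rightarrow> ('a \<Rightarrow> nat) set \<Rightarrow> 'a measure" where
  "sigma_generated M G = sigma (space M) {g -` A \<inter> space M | g A. g \<in> G}"

definition natural_filtration :: "'a measure \<Rightarrow> (nat \<Rightarrow> 'a \<Rightarrow> nat) \<Rightarrow> nat \<Rightarrow> 'a measure" where
  "natural_filtration M X n = sigma_generated M (X ` {0..n})"

definition stretch_start :: "(nat \<Rightarrow> 'a \<Rightarrow> nat) \<Rightarrow> nat \<Rightarrow> 'a \<Rightarrow> nat" where
  "stretch_start X n \<omega> = Inf {k. k \<le> n \<and> (\<forall>i\<in>{k..<n}. X (i + 1) \<omega> < X i \<omega>)}"

definition stretch_value :: "(nat \<Rightarrow> 'a \<Rightarrow> nat) \<Rightarrow> nat \<Rightarrow> nat \<Rightarrow> 'a \<Rightarrow> nat" where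
  "stretch_value X i n \<omega> = (if stretch_start X n \<omega> \<le> i \<and> i \<le> n then X i \<omega> else 0)"

definition stretch_sigma :: "'a measure \<Rightarrow> (nat \<Rightarrow> 'a \<Rightarrow> nat) \<Rightarrow> nat \<Rightarrow> 'a measure" where
  "stretch_sigma M X n =
     sigma_generated M (insert (stretch_start X n) ((\<lambda>i. stretch_value X i n) ` {0..n}))"

text \<open>The conditional probability of the event \<open>P\<close> given the sub-\<open>\<sigma>\<close>-algebra \<open>F\<close>. The library's
  \<open>cond_prob\<close> conditions on an event instead.\<close>

definition prob_given :: "'a measure \<Rightarrow> 'a measure \<Rightarrow> ('a \<Rightarrow> bool) \<Rightarrow> 'a \<Rightarrow> real" where
  "prob_given M F P = real_cond_exp M F (indicator {\<omega> \<in> space M. P \<omega>})"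

text \<open>The conditional expectation is taken in \<open>ennreal\<close>, since integrability of the exponential is
  part of what finiteness of this quantity asserts.\<close>

definition jump_exp_moment :: "'a measure \<Rightarrow> (nat \<Rightarrow> 'a \<Rightarrow> nat) \<Rightarrow> real \<Rightarrow> ennreal" where
  "jump_exp_moment M X \<alpha> =
     esssup M (\<lambda>\<omega>. SUP n. nn_cond_exp M (stretch_sigma M X n)
       (\<lambda>\<omega>. ennreal (exp (\<alpha> * max (real (X (n + 1) \<omega>) - real (X n \<omega>)) 0))) \<omega>)"

text \<open>The infimum of the empty set in \<open>enat\<close> is \<open>\<infinity>\<close>.\<close>

definition hitting_time :: "(nat \<Rightarrow> 'a \<Rightarrow> nat) \<Rightarrow> nat \<Rightarrow> 'a \<Rightarrow> enat" where
  "hitting_time X N \<omega> = (INF t\<in>{t. X t \<omega> \<le> N}. enat t)"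

definition exp_enat :: "real \<Rightarrow> enat \<Rightarrow> ennreal" where
  "exp_enat \<alpha> t = (case t of enat k \<Rightarrow> ennreal (exp (\<alpha> * real k)) | \<infinity> \<Rightarrow> \<infinity>)"

definition start_measure :: "'a measure \<Rightarrow> (nat \<Rightarrow> 'a \<Rightarrow> nat) \<Rightarrow> nat \<Rightarrow> 'a measure" where
  "start_measure M X v = uniform_measure M {\<omega> \<in> space M. X 0 \<omega> = v}"

end

theory Submission
  imports Defs
begin

text \<open>The Lyapunov function is \<open>exp (\<alpha> * (n + X\<^sub>n)) * g (n - \<zeta>\<^sub>n)\<close>, where \<open>\<zeta>\<^sub>n\<close> is the start of
  the current strictly decreasing stretch. The quantity \<open>n + X\<^sub>n\<close> can only grow at a step that ends a
  stretch; after \<open>m\<close> descents this has probability at most \<open>1 - \<kappa> m \<le> C * exp (- r * m)\<close>. Such a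
  step changes \<open>exp (\<alpha> * (n + X\<^sub>n))\<close> by a factor whose expected excess over 1 on this event is at
  most \<open>\<alpha> * L * exp (- r * m / 2)\<close>, by Young's inequality. As \<open>(\<Prod>i. \<kappa> i) > 0\<close>, for small \<open>\<alpha>\<close>
  these excesses, together with the probabilities of ending the stretch, are absorbed by a weight \<open>g\<close>
  with values in \<open>[1/2, 1]\<close> and \<open>g 0 = 1\<close>. The process stopped at \<open>\<tau>\<close> is then a supermartingale,
  which gives \<open>C\<^sub>1 = 2\<close>. The conditional estimates, given for the stretch \<open>\<sigma>\<close>-algebra, may be used under
  the natural filtration because of (A1).\<close>

subsection \<open>The stretch \<open>\<sigma>\<close>-algebra\<close>

lemma measurable_sigma_generated:
  assumes "g \<in> G"
  shows "g \<in> measurable (sigma_generated M G) (count_space UNIV)"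
proof (rule measurableI)
  fix A assume "A \<in> sets (count_space (UNIV :: nat set))"
  have "g -` A \<inter> space M \<in> {g -` A \<inter> space M | g A. g \<in> G}"
    using assms by blast
  then show "g -` A \<inter> space (sigma_generated M G) \<in> sets (sigma_generated M G)"
    unfolding sigma_generated_def by (subst space_measure_of sets_measure_of, blast)+ blast
qed simp

lemma subalgebra_sigma_generated:
  assumes "space F = space M" and "\<And>g. g \<in> G \<Longrightarrow> g \<in> measurable F (count_space UNIV)"
  shows "subalgebra F (sigma_generated M G)"
proof -
  have "{g -` A \<inter> space M | g A. g \<in> G} \<subseteq> sets F"
    using assms(2) by (auto simp: assms(1)[symmetric] intro!: measurable_sets)
  then have "sigma_sets (space M) {g -` A \<inter> space M | g A. g \<in> G} \<subseteq> sets F"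
    using sets.sigma_sets_subset[of _ F] assms(1) by simp
  then show ?thesis
    unfolding subalgebra_def sigma_generated_def
    by (subst space_measure_of sets_measure_of, blast)+ (simp add: assms(1))
qed

lemma stretch_start_le: "stretch_start X n \<omega> \<le> n"
  unfolding stretch_start_def by (rule cInf_lower) auto

lemma stretch_start_decreasing:
  assumes "stretch_start X n \<omega> \<le> i" "i < n"
  shows "X (i + 1) \<omega> < X i \<omega>"
proof -
  have "stretch_start X n \<omega> \<in> {k. k \<le> n \<and> (\<forall>i\<in>{k..<n}. X (i + 1) \<omega> < X i \<omega>)}"
    unfolding stretch_start_def by (rule Inf_nat_def1) (auto intro: exI[of _ n])
  with assms show ?thesis by auto
qed

lemma stretch_start_0: "stretch_start X 0 \<omega> = 0"
  using stretch_start_le[of X 0 \<omega>] by simp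

text \<open>A descent prolongs the stretch by one step; any other step resets the length
  \<open>n - stretch_start X n \<omega>\<close> to 0. Both the measurability of the start and the
  form of the one-step drift come from this recursion.\<close>

lemma stretch_start_Suc:
  "stretch_start X (Suc n) \<omega> = (if X (Suc n) \<omega> < X n \<omega> then stretch_start X n \<omega> else Suc n)"
proof (cases "X (Suc n) \<omega> < X n \<omega>")
  case True
  have "stretch_start X (Suc n) \<omega> \<le> stretch_start X n \<omega>"
    using True stretch_start_decreasing[of X n \<omega>] stretch_start_le[of X n \<omega>]
    by (subst stretch_start_def, intro cInf_lower) (auto simp: less_Suc_eq)
  moreover have "stretch_start X n \<omega> \<le> stretch_start X (Suc n) \<omega>"
    using stretch_start_decreasing[of X "Suc n" \<omega>] calculation stretch_start_le[of X n \<omega>]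
    by (subst stretch_start_def, intro cInf_lower) auto
  ultimately show ?thesis using True by simp
next
  case False
  then show ?thesis
    using stretch_start_decreasing[of X "Suc n" \<omega> n] stretch_start_le[of X "Suc n" \<omega>] by force
qed

text \<open>Every subset of \<open>nat\<close> is Borel, so the two target \<sigma>-algebras agree.
  The Borel form is the one used to measure comparisons such as
  \<open>X (Suc n) \<omega> < X n \<omega>\<close>.\<close>

lemma borel_measurable_count_space_nat:
  "(f :: 'a \<Rightarrow> nat) \<in> measurable F (count_space UNIV) \<Longrightarrow> f \<in> borel_measurable F"
  by (subst measurable_cong_sets[OF refl sets_borel_eq_count_space])

text \<open>Induction along the recursion. \<open>F\<close> is arbitrary because both
  \<open>natural_filtration M X n\<close> and \<open>M\<close> itself are inserted later.\<close>

lemma measurable_stretch_start: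
  assumes [measurable]: "\<And>i. i \<le> n \<Longrightarrow> X i \<in> measurable F (count_space UNIV)"
  shows "stretch_start X n \<in> measurable F (count_space UNIV)"
  using assms
proof (induction n)
  case 0
  then show ?case by (simp add: stretch_start_0 [abs_def])
next
  case (Suc n)
  have [measurable]: "X n \<in> measurable F (count_space UNIV)"
    "X (Suc n) \<in> measurable F (count_space UNIV)"
    "stretch_start X n \<in> measurable F (count_space UNIV)"
    by (rule Suc.prems Suc.IH; simp add: Suc.prems)+
  then have [measurable]: "X n \<in> borel_measurable F" "X (Suc n) \<in> borel_measurable F"
    by (simp_all add: borel_measurable_count_space_nat)
  show ?case unfolding stretch_start_Suc [abs_def] by measurable
qed

context
  fixes M :: "'a measure" and X :: "nat \<Rightarrow> 'a \<Rightarrow> nat"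
  assumes X: "\<And>n. X n \<in> measurable M (count_space UNIV)"
begin

lemma subalgebra_natural_filtration: "subalgebra M (natural_filtration M X n)"
  unfolding natural_filtration_def by (rule subalgebra_sigma_generated) (auto simp: X)

lemma measurable_natural_filtration:
  "i \<le> n \<Longrightarrow> X i \<in> measurable (natural_filtration M X n) (count_space UNIV)"
  unfolding natural_filtration_def by (rule measurable_sigma_generated) auto

lemma subalgebra_stretch_sigma: "subalgebra (natural_filtration M X n) (stretch_sigma M X n)"
  unfolding stretch_sigma_def
proof (rule subalgebra_sigma_generated)
  show "space (natural_filtration M X n) = space M"
    using subalgebra_natural_filtration by (simp add: subalgebra_def)
  note [measurable] = measurable_natural_filtration
  have [measurable]: "stretch_start X n \<in> measurable (natural_filtration M X n) (count_space UNIV)"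
    by (rule measurable_stretch_start) measurable
  fix g assume "g \<in> insert (stretch_start X n) ((\<lambda>i. stretch_value X i n) ` {0..n})"
  moreover have "stretch_value X i n \<in> measurable (natural_filtration M X n) (count_space UNIV)"
    if [simp]: "i \<le> n" for i
    unfolding stretch_value_def [abs_def] by measurable
  ultimately show "g \<in> measurable (natural_filtration M X n) (count_space UNIV)"
    by auto
qed

text \<open>The stretch always contains its endpoint, since \<zeta> at time \<open>n\<close> is at
  most \<open>n\<close>; hence \<open>X n\<close> is one of the generators.\<close>

lemma measurable_stretch_sigma_last:
  "X n \<in> measurable (stretch_sigma M X n) (count_space UNIV)"
proof -
  have "stretch_value X n n = X n"
    by (simp add: stretch_value_def fun_eq_iff stretch_start_le)
  then show ?thesis
    unfolding stretch_sigma_def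
    by (intro measurable_sigma_generated insertI2 image_eqI[of _ _ n]) auto
qed

end

subsection \<open>Conditional expectations\<close>

text \<open>The real conditional expectation is the difference of those of the positive and negative
  parts. For an indicator the first is at most 1, hence finite, and the second vanishes. This links
  the real-valued (A1) and (A3) to the calculations in \<open>ennreal\<close>.\<close>

lemma ennreal_real_cond_exp_indicator:
  assumes "finite_measure M" "subalgebra M F" and [measurable]: "A \<in> sets M"
  shows "AE \<omega> in M. ennreal (real_cond_exp M F (indicator A) \<omega>) = nn_cond_exp M F (indicator A) \<omega>"
proof -
  interpret finite_measure_subalgebra M F
    using assms by (simp add: finite_measure_subalgebra_def finite_measure_subalgebra_axioms_def)
  have "AE \<omega> in M. nn_cond_exp M F (indicator A) \<omega> \<le> nn_cond_exp M F (\<lambda>_. 1) \<omega>"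
    by (rule nn_cond_exp_mono) (auto simp: indicator_def)
  moreover have "AE \<omega> in M. 1 = nn_cond_exp M F (\<lambda>_. 1) \<omega>"
    by (rule nn_cond_exp_F_meas) simp
  moreover have "AE \<omega> in M. 0 = nn_cond_exp M F (\<lambda>_. 0) \<omega>"
    by (rule nn_cond_exp_F_meas) simp
  ultimately show ?thesis
  proof eventually_elim
    case (elim \<omega>)
    have "(\<lambda>x. ennreal (indicator A x)) = indicator A" "(\<lambda>x. ennreal (- indicator A x)) = (\<lambda>_. 0)"
      by (auto simp: fun_eq_iff indicator_def ennreal_neg)
    moreover from elim have "nn_cond_exp M F (indicator A) \<omega> < top"
      by (metis ennreal_one_less_top le_less_trans)
    ultimately show ?case
      using elim by (simp add: real_cond_exp_def)
  qed
qed

text \<open>Conditional probabilities of complementary events add up to 1, and finiteness permits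
  subtraction. This turns the lower bound for a descent in (A3) into an upper bound for its
  failure.\<close>

lemma nn_cond_exp_compl_le:
  assumes "finite_measure M" "subalgebra M F" and [measurable]: "A \<in> sets M"
    and ae: "AE \<omega> in M. Q \<omega> \<longrightarrow> k \<le> real_cond_exp M F (indicator A) \<omega>"
    and "0 \<le> k"
  shows "AE \<omega> in M. Q \<omega> \<longrightarrow> nn_cond_exp M F (indicator (space M - A)) \<omega> \<le> ennreal (1 - k)"
proof -
  interpret finite_measure_subalgebra M F
    using assms by (simp add: finite_measure_subalgebra_def finite_measure_subalgebra_axioms_def)
  have "AE \<omega> in M. nn_cond_exp M F (indicator A) \<omega> + nn_cond_exp M F (indicator (space M - A)) \<omega>
      = nn_cond_exp M F (\<lambda>\<omega>. indicator A \<omega> + indicator (space M - A) \<omega>) \<omega>"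
    by (rule nn_cond_exp_sum) auto
  moreover have "AE \<omega> in M. nn_cond_exp M F (\<lambda>\<omega>. indicator A \<omega> + indicator (space M - A) \<omega>) \<omega>
      = nn_cond_exp M F (\<lambda>_. 1) \<omega>"
    by (rule nn_cond_exp_cong) (auto simp: indicator_def)
  moreover have "AE \<omega> in M. 1 = nn_cond_exp M F (\<lambda>_. 1) \<omega>"
    by (rule nn_cond_exp_F_meas) simp
  ultimately show ?thesis
    using ae ennreal_real_cond_exp_indicator[OF assms(1-3)]
  proof eventually_elim
    case (elim \<omega>)
    show ?case
    proof
      assume "Q \<omega>"
      let ?p = "nn_cond_exp M F (indicator A) \<omega>" and ?q = "nn_cond_exp M F (indicator (space M - A)) \<omega>"
      have 1: "?p + ?q = 1" using elim by simp
      have 2: "ennreal k \<le> ?p" using elim \<open>Q \<omega>\<close> by (metis ennreal_leI)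
      have "?p \<noteq> top" using 1 by auto
      then have "?q = 1 - ?p" using 1 by (metis ennreal_add_diff_cancel_left)
      also have "\<dots> \<le> 1 - ennreal k" using 2 by (rule ennreal_minus_mono[OF order_refl])
      also have "\<dots> = ennreal (1 - k)" using \<open>0 \<le> k\<close> by (simp add: ennreal_minus flip: ennreal_1)
      finally show "?q \<le> ennreal (1 - k)" .
    qed
  qed
qed

text \<open>Carries (A1) from the events \<open>Y \<omega> = j\<close> to functions of
  \<open>Y\<close> and of data in the smaller \<sigma>-algebra \<open>G\<close>. After splitting by
  the value of \<open>Y\<close>, each \<open>f j\<close> is pulled out of the conditional
  expectation, and both sides become the sum of \<open>f j * p j\<close> with the common conditional
  probabilities \<open>p j\<close>.\<close>

lemma nn_cond_exp_eq_of_nat_valued: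
  fixes Y :: "'a \<Rightarrow> nat" and f :: "nat \<Rightarrow> 'a \<Rightarrow> ennreal"
  assumes M: "finite_measure M" "subalgebra M F" "subalgebra F G"
    and Y [measurable]: "Y \<in> measurable M (count_space UNIV)"
    and f: "\<And>j. f j \<in> borel_measurable G"
    and eq: "\<And>j. AE \<omega> in M. nn_cond_exp M F (indicator {\<omega> \<in> space M. Y \<omega> = j}) \<omega>
                   = nn_cond_exp M G (indicator {\<omega> \<in> space M. Y \<omega> = j}) \<omega>"
  shows "AE \<omega> in M. nn_cond_exp M F (\<lambda>\<omega>. f (Y \<omega>) \<omega>) \<omega> = nn_cond_exp M G (\<lambda>\<omega>. f (Y \<omega>) \<omega>) \<omega>"
proof -
  have MG: "subalgebra M G" using M by (auto simp: subalgebra_def)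
  define p where "p j = nn_cond_exp M G (indicator {\<omega> \<in> space M. Y \<omega> = j})" for j
  have pG [measurable]: "p j \<in> borel_measurable G" for j
    unfolding p_def by simp
  have pF [measurable]: "p j \<in> borel_measurable F" for j
    by (rule measurable_from_subalg[OF M(3) pG])
  have pM [measurable]: "p j \<in> borel_measurable M" for j
    by (rule measurable_from_subalg[OF M(2) pF])
  note f [measurable]
  have fF [measurable]: "f j \<in> borel_measurable F" for j
    by (rule measurable_from_subalg[OF M(3) f])
  have fM [measurable]: "f j \<in> borel_measurable M" for j
    by (rule measurable_from_subalg[OF M(2) fF])
  \<comment> \<open>Proved for every \<open>H\<close> containing \<open>G\<close> and contained in
    \<open>M\<close>, so that \<open>F\<close> and \<open>G\<close> can both be inserted;
    \<open>f j\<close> and \<open>p j\<close> are then measurable for \<open>H\<close>.\<close>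
  have "AE \<omega> in M. (\<Sum>j. f j \<omega> * p j \<omega>) = nn_cond_exp M H (\<lambda>\<omega>. f (Y \<omega>) \<omega>) \<omega>"
    if H: "subalgebra M H" "subalgebra H G"
      and eq: "\<And>j. AE \<omega> in M. nn_cond_exp M H (indicator {\<omega> \<in> space M. Y \<omega> = j}) \<omega> = p j \<omega>" for H
  proof -
    interpret finite_measure_subalgebra M H
      using M H by (simp add: finite_measure_subalgebra_def finite_measure_subalgebra_axioms_def)
    have [measurable]: "f j \<in> borel_measurable H" "p j \<in> borel_measurable H" for j
      by (rule measurable_from_subalg[OF H(2)], simp add: f pG)+
    show ?thesis
    proof (rule nn_cond_exp_charact)
      fix A assume A [measurable]: "A \<in> sets H"
      then have [measurable]: "A \<in> sets M" using H(1) by (auto simp: subalgebra_def)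
      have "(\<integral>\<^sup>+\<omega>\<in>A. f (Y \<omega>) \<omega> \<partial>M)
        = (\<integral>\<^sup>+\<omega>. (\<Sum>j. indicator A \<omega> * f j \<omega> * indicator {\<omega> \<in> space M. Y \<omega> = j} \<omega>) \<partial>M)"
      proof (rule nn_integral_cong)
        fix \<omega> assume "\<omega> \<in> space M"
        then have "(\<Sum>j. indicator A \<omega> * f j \<omega> * indicator {\<omega> \<in> space M. Y \<omega> = j} \<omega>)
           = (\<Sum>j\<in>{Y \<omega>}. indicator A \<omega> * f j \<omega> * indicator {\<omega> \<in> space M. Y \<omega> = j} \<omega>)"
          by (intro suminf_finite) (auto simp: indicator_def)
        also have "\<dots> = f (Y \<omega>) \<omega> * indicator A \<omega>"
          using \<open>\<omega> \<in> space M\<close> by (cases "\<omega> \<in> A") auto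
        finally show "f (Y \<omega>) \<omega> * indicator A \<omega>
          = (\<Sum>j. indicator A \<omega> * f j \<omega> * indicator {\<omega> \<in> space M. Y \<omega> = j} \<omega>)"
          by (rule sym)
      qed
      also have "\<dots> = (\<Sum>j. \<integral>\<^sup>+\<omega>. indicator A \<omega> * f j \<omega> * indicator {\<omega> \<in> space M. Y \<omega> = j} \<omega> \<partial>M)"
        by (rule nn_integral_suminf) simp
      also have "\<dots> = (\<Sum>j. \<integral>\<^sup>+\<omega>. indicator A \<omega> * f j \<omega> * p j \<omega> \<partial>M)"
      proof (rule suminf_cong)
        fix j
        have "(\<integral>\<^sup>+\<omega>. indicator A \<omega> * f j \<omega> * indicator {\<omega> \<in> space M. Y \<omega> = j} \<omega> \<partial>M)
          = (\<integral>\<^sup>+\<omega>. indicator A \<omega> * f j \<omega> * nn_cond_exp M H (indicator {\<omega> \<in> space M. Y \<omega> = j}) \<omega> \<partial>M)"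
          by (rule nn_cond_exp_intg[symmetric]) auto
        also have "\<dots> = (\<integral>\<^sup>+\<omega>. indicator A \<omega> * f j \<omega> * p j \<omega> \<partial>M)"
          using eq[of j] by (intro nn_integral_cong_AE) auto
        finally show "(\<integral>\<^sup>+\<omega>. indicator A \<omega> * f j \<omega> * indicator {\<omega> \<in> space M. Y \<omega> = j} \<omega> \<partial>M)
          = (\<integral>\<^sup>+\<omega>. indicator A \<omega> * f j \<omega> * p j \<omega> \<partial>M)" .
      qed
      also have "\<dots> = (\<integral>\<^sup>+\<omega>. (\<Sum>j. indicator A \<omega> * f j \<omega> * p j \<omega>) \<partial>M)"
        by (rule nn_integral_suminf[symmetric]) simp
      also have "\<dots> = (\<integral>\<^sup>+\<omega>\<in>A. (\<Sum>j. f j \<omega> * p j \<omega>) \<partial>M)"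
        by (simp add: ac_simps)
      finally show "(\<integral>\<^sup>+\<omega>\<in>A. f (Y \<omega>) \<omega> \<partial>M) = (\<integral>\<^sup>+\<omega>\<in>A. (\<Sum>j. f j \<omega> * p j \<omega>) \<partial>M)" .
    qed measurable
  qed
  from this[of F] this[of G] show ?thesis
    using M MG eq by (auto simp: p_def subalgebra_def)
qed

subsection \<open>The Lyapunov weights\<close>

text \<open>The excess over 1 carries a factor \<alpha>, so it vanishes with \<alpha>, and \<theta>
  is free to trade the exponential moment against a constant. With
  \<open>y = exp (\<beta> * s / 4)\<close>, both \<open>s\<close> (up to \<open>4 / \<beta>\<close>)
  and \<open>exp (\<alpha> * s)\<close> are at most \<open>y\<close>, and
  \<open>2 * y\<^sup>2 \<le> \<theta> * y ^ 4 + 1 / \<theta>\<close> by completing the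
  square.\<close>

lemma exp_le_Young:
  fixes \<alpha> \<beta> \<theta> s :: real
  assumes "0 < \<alpha>" "\<alpha> \<le> \<beta> / 4" "0 \<le> s" "0 < \<theta>"
  shows "exp (\<alpha> * s) \<le> 1 + \<alpha> * (2 / \<beta>) * (\<theta> * exp (\<beta> * s) + 1 / \<theta>)"
proof -
  have \<beta>: "0 < \<beta>" using assms by simp
  define y where "y = exp (\<beta> * s / 4)"
  have y: "y > 0" by (simp add: y_def)
  \<comment> \<open>Multiplying by \<open>exp (\<alpha> * s)\<close> gives
    \<open>exp x \<le> 1 + x * exp x\<close> at \<open>x = \<alpha> * s\<close>.\<close>
  have "1 - \<alpha> * s \<le> exp (- (\<alpha> * s))"
    using exp_ge_add_one_self[of "- (\<alpha> * s)"] by simp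
  then have "(1 - \<alpha> * s) * exp (\<alpha> * s) \<le> exp (- (\<alpha> * s)) * exp (\<alpha> * s)"
    by (rule mult_right_mono) simp
  then have "exp (\<alpha> * s) \<le> 1 + \<alpha> * (s * exp (\<alpha> * s))"
    by (simp add: exp_minus_inverse algebra_simps flip: exp_add)
  moreover have "s * exp (\<alpha> * s) \<le> (4 / \<beta> * y) * y"
  proof (rule mult_mono)
    have "\<beta> * s / 4 \<le> y" unfolding y_def using exp_ge_add_one_self[of "\<beta> * s / 4"] by linarith
    then show "s \<le> 4 / \<beta> * y" using \<beta> by (simp add: field_simps)
    have "\<alpha> * s \<le> \<beta> / 4 * s" by (rule mult_right_mono) (use assms in auto)
    then show "exp (\<alpha> * s) \<le> y" by (simp add: y_def)
  qed (use y \<beta> in auto)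
  then have "\<alpha> * (s * exp (\<alpha> * s)) \<le> \<alpha> * ((4 / \<beta> * y) * y)"
    by (rule mult_left_mono) (use assms in auto)
  moreover have "\<alpha> * ((4 / \<beta> * y) * y) = \<alpha> * (2 / \<beta>) * (2 * y\<^sup>2)"
    by (simp add: power2_eq_square)
  moreover have "2 * y\<^sup>2 \<le> \<theta> * y ^ 4 + 1 / \<theta>"
  proof -
    have "0 \<le> (\<theta> * y\<^sup>2 - 1)\<^sup>2 / \<theta>" using assms by simp
    also have "\<dots> = \<theta> * y ^ 4 + 1 / \<theta> - 2 * y\<^sup>2"
      using assms by (simp add: power2_eq_square power4_eq_xxxx field_simps)
    finally show ?thesis by simp
  qed
  then have "\<alpha> * (2 / \<beta>) * (2 * y\<^sup>2) \<le> \<alpha> * (2 / \<beta>) * (\<theta> * y ^ 4 + 1 / \<theta>)"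
    by (rule mult_left_mono) (use assms \<beta> in auto)
  ultimately have "exp (\<alpha> * s) \<le> 1 + \<alpha> * (2 / \<beta>) * (\<theta> * y ^ 4 + 1 / \<theta>)"
    by linarith
  moreover have "y ^ 4 = exp (\<beta> * s)"
    by (simp add: y_def flip: exp_of_nat_mult)
  ultimately show ?thesis by simp
qed

text \<open>The first two terms of the inequality equal
  \<open>\<kappa> m * g (Suc m) + (1 - \<kappa> m) * 1\<close>: the mean weight after a step that
  succeeds with probability \<open>\<kappa> m\<close> and otherwise resets the weight to
  \<open>g 0 = 1\<close>. The third term is the room left for the excess of a failed step.\<close>

lemma eventually_stretch_weights:
  fixes \<kappa> :: "nat \<Rightarrow> real"
  assumes \<kappa>: "\<And>m. 0 < \<kappa> m" "\<And>m. \<kappa> m \<le> 1" "convergent_prod \<kappa>" "(\<Prod>i. \<kappa> i) > 0"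
    and "0 \<le> L" "0 < r"
  shows "\<forall>\<^sub>F \<alpha> in at_right 0. \<exists>g :: nat \<Rightarrow> real. g 0 = 1 \<and> (\<forall>m. 1 / 2 \<le> g m \<and> g m \<le> 1 \<and>
    g (Suc m) + (1 - g (Suc m)) * (1 - \<kappa> m) + \<alpha> * L * exp (- r * real m) \<le> g m)"
proof -
  define P where "P m = (\<Prod>i<m. \<kappa> i)" for m
  define q where "q = (\<Prod>i. \<kappa> i)"
  define T where "T = (\<Sum>i. exp (- r) ^ i)"
  have summ: "summable (\<lambda>i. exp (- r) ^ i)"
    using \<open>0 < r\<close> by (intro summable_geometric) simp
  have T0: "0 \<le> T" unfolding T_def by (rule suminf_nonneg[OF summ]) simp
  have P_pos: "0 < P m" and P_le: "P m \<le> 1" for m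
    unfolding P_def using \<kappa>(1,2) by (auto intro: prod_pos prod_le_1 less_imp_le)
  have P_Suc: "P (Suc m) = P m * \<kappa> m" for m by (simp add: P_def)
  have "decseq P"
    by (rule decseq_SucI) (use P_Suc P_pos \<kappa>(2) in \<open>auto intro: mult_left_le less_imp_le\<close>)
  \<comment> \<open>Partial products in the convergence theorem include the last index, whereas
    \<open>P m\<close> stops before \<open>m\<close>; hence the index shift.\<close>
  moreover have "P \<longlonglongrightarrow> q"
    using convergent_prod_LIMSEQ[OF \<kappa>(3)] unfolding P_def q_def
    by (subst filterlim_sequentially_Suc[symmetric]) (simp add: lessThan_Suc_atMost)
  ultimately have q_le: "q \<le> P m" for m by (rule decseq_ge)
  have q: "0 < q" using \<kappa>(4) by (simp add: q_def)
  \<comment> \<open>The threshold forces \<open>S m \<le> q / 2 \<le> P m / 2\<close>, which is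
    \<open>g m \<ge> 1 / 2\<close>. The summand 1 keeps the denominator positive when
    \<open>L = 0\<close>.\<close>
  have "\<forall>\<^sub>F \<alpha> in at_right 0. \<alpha> \<in> {0<..<q / (2 * (L * T + 1))}"
    using q T0 \<open>0 \<le> L\<close> by (intro eventually_at_right_real) (simp add: add_nonneg_pos)
  then show ?thesis
  proof eventually_elim
    case (elim \<alpha>)
    define S where "S m = (\<Sum>i<m. \<alpha> * L * exp (- r) ^ i)" for m
    have pos: "0 < 2 * (L * T + 1)" using T0 \<open>0 \<le> L\<close> by (simp add: add_nonneg_pos)
    have S0: "0 \<le> S m" for m
      unfolding S_def using elim \<open>0 \<le> L\<close> by (auto intro!: sum_nonneg)
    have S_le: "S m \<le> q / 2" for m
    proof -
      have "(\<Sum>i<m. exp (- r) ^ i) \<le> T"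
        unfolding T_def by (rule sum_le_suminf[OF summ]) auto
      then have "S m \<le> \<alpha> * L * T"
        unfolding S_def sum_distrib_left[symmetric] using elim \<open>0 \<le> L\<close> by (intro mult_left_mono) auto
      also have "\<dots> \<le> \<alpha> * (L * T + 1)" using elim by (simp add: algebra_simps)
      also have "\<dots> \<le> q / 2" using elim pos by (simp add: field_simps)
      finally show ?thesis .
    qed
    txt \<open>This \<open>1 - g\<close> solves \<open>\<kappa> m * u (Suc m) = u m + e\<^sub>m / P m\<close> with \<open>u 0 = 0\<close>, where
      \<open>e\<^sub>m = \<alpha> * L * exp (- r * m)\<close>.\<close>
    define g where "g m = 1 - S m / P m" for m
    have "g 0 = 1" by (simp add: g_def S_def)
    moreover have "1 / 2 \<le> g m" for m
      using S_le[of m] q_le[of m] P_pos[of m] by (simp add: g_def field_simps)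
    moreover have "g m \<le> 1" for m
      using S0[of m] P_pos[of m] by (simp add: g_def)
    moreover have "g (Suc m) + (1 - g (Suc m)) * (1 - \<kappa> m) + \<alpha> * L * exp (- r * real m) \<le> g m" for m
    proof -
      let ?e = "\<alpha> * L * exp (- r) ^ m"
      have "\<kappa> m * (1 - g (Suc m)) = (S m + ?e) / P m"
        using \<kappa>(1)[of m] P_pos[of m] by (simp add: g_def P_Suc S_def)
      also have "\<dots> = 1 - g m + ?e / P m"
        by (simp add: g_def add_divide_distrib)
      finally have "\<kappa> m * (1 - g (Suc m)) = 1 - g m + ?e / P m" .
      moreover have "?e \<le> ?e / P m"
        using elim \<open>0 \<le> L\<close> P_pos[of m] P_le[of m] by (simp add: le_divide_eq mult_left_le)
      moreover have "exp (- r) ^ m = exp (- r * real m)"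
        by (simp add: mult.commute flip: exp_of_nat_mult)
      ultimately show ?thesis by (simp add: algebra_simps)
    qed
    ultimately show ?case by blast
  qed
qed

text \<open>\<open>Z\<close> stands for the length of the stretch, \<open>Y\<close> and
  \<open>Y'\<close> for the present and next state, and \<open>D\<close> for an event known at
  present. A failure costs \<open>A * (\<theta> * exp \<beta> * J + 1 / \<theta>)\<close> beyond 1,
  by Young's inequality. Conditionally on \<open>F\<close>, the moment bound controls the first part
  by a multiple of \<theta>; the second is weighted by a failure probability of order
  \<open>\<theta>\<^sup>2\<close>. The total has order \<theta> and is absorbed by
  \<open>g\<close>.\<close>

lemma drift_one_step:
  fixes Y Y' Z :: "'a \<Rightarrow> nat" and \<kappa> g :: "nat \<Rightarrow> real"
  assumes M: "prob_space M" "subalgebra M F"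
    and meas: "Z \<in> measurable F (count_space UNIV)" "Y \<in> measurable F (count_space UNIV)"
      "Y' \<in> measurable M (count_space UNIV)" "D \<in> sets F"
    and fail: "AE \<omega> in M. \<omega> \<in> D \<longrightarrow>
      nn_cond_exp M F (indicator {\<omega> \<in> space M. \<not> Y' \<omega> < Y \<omega>}) \<omega> \<le> ennreal (1 - \<kappa> (Z \<omega>))"
    and jump: "AE \<omega> in M.
      nn_cond_exp M F (\<lambda>\<omega>. ennreal (exp (\<beta> * max (real (Y' \<omega>) - real (Y \<omega>)) 0))) \<omega> \<le> ennreal K"
    and K: "0 \<le> K" and \<kappa>: "\<And>m. \<kappa> m \<le> 1" "\<And>m. 1 - \<kappa> m \<le> C * exp (- r * real m)"
    and \<alpha>: "0 < \<alpha>" "\<alpha> \<le> \<beta> / 4"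
    and g: "\<And>m. 0 \<le> g m" "\<And>m. g m \<le> 1"
      "\<And>m. g (Suc m) + (1 - g (Suc m)) * (1 - \<kappa> m)
         + \<alpha> * (2 / \<beta> * (exp \<beta> * K + C)) * exp (- (r / 2) * real m) \<le> g m"
  shows "(\<integral>\<^sup>+\<omega>\<in>D. ennreal (exp (\<alpha> * (1 + real (Y' \<omega>)))
        * (if Y' \<omega> < Y \<omega> then g (Suc (Z \<omega>)) else 1)) \<partial>M)
    \<le> (\<integral>\<^sup>+\<omega>\<in>D. ennreal (exp (\<alpha> * real (Y \<omega>)) * g (Z \<omega>)) \<partial>M)"
proof -
  interpret finite_measure_subalgebra M F
    using M by (simp add: finite_measure_subalgebra_def finite_measure_subalgebra_axioms_def
        prob_space.finite_measure)
  define A where "A = \<alpha> * (2 / \<beta>)"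
  have A: "0 \<le> A" using \<alpha> by (simp add: A_def)
  \<comment> \<open>Half the rate \<open>r\<close>: this balances the failure probability
    \<open>C * exp (- r * m)\<close> against the bounded jump moment.\<close>
  define \<theta> where "\<theta> m = exp (- (r / 2) * real m)" for m
  have \<theta>: "0 < \<theta> m" for m by (simp add: \<theta>_def)
  \<comment> \<open>\<open>a\<^sub>1\<close> is the coefficient of the failure indicator, including
    the reset of the weight from \<open>g (Suc m)\<close> to 1; \<open>a\<^sub>2\<close> is that of
    the jump exponential.\<close>
  define a\<^sub>1 where "a\<^sub>1 m = 1 - g (Suc m) + A / \<theta> m" for m
  define a\<^sub>2 where "a\<^sub>2 m = A * \<theta> m * exp \<beta>" for m
  have a: "0 \<le> a\<^sub>1 m" "0 \<le> a\<^sub>2 m" for m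
    using A \<theta>[of m] g(2)[of "Suc m"] by (auto simp: a\<^sub>1_def a\<^sub>2_def)
  define c where "c \<omega> = exp (\<alpha> * real (Y \<omega>))" for \<omega>
  have c: "0 \<le> c \<omega>" for \<omega> by (simp add: c_def)
  define U where "U = {\<omega> \<in> space M. \<not> Y' \<omega> < Y \<omega>}"
  define J where "J \<omega> = exp (\<beta> * max (real (Y' \<omega>) - real (Y \<omega>)) 0)" for \<omega>

  note meas [measurable]
  have [measurable]: "Y \<in> measurable M (count_space UNIV)" "Z \<in> measurable M (count_space UNIV)"
    "D \<in> sets M"
    using meas M(2) by (auto intro: measurable_from_subalg simp: subalgebra_def)
  have [measurable]: "Y \<in> borel_measurable M" "Y' \<in> borel_measurable M"
    by (auto intro: borel_measurable_count_space_nat)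
  have [measurable]: "U \<in> sets M" "J \<in> borel_measurable M" unfolding U_def J_def by measurable
  have [measurable]: "c \<in> borel_measurable F" "c \<in> borel_measurable M"
    unfolding c_def by measurable

  \<comment> \<open>Pointwise majorant. States are integers, so a descent gives
    \<open>1 + Y' \<omega> \<le> Y \<omega>\<close> and the exponential does not grow; the other
    terms are then nonnegative surplus.\<close>
  have le: "exp (\<alpha> * (1 + real (Y' \<omega>))) * (if Y' \<omega> < Y \<omega> then g (Suc (Z \<omega>)) else 1)
    \<le> c \<omega> * (g (Suc (Z \<omega>)) + a\<^sub>1 (Z \<omega>) * indicator U \<omega> + a\<^sub>2 (Z \<omega>) * J \<omega>)"
    if "\<omega> \<in> space M" for \<omega>
  proof (cases "Y' \<omega> < Y \<omega>")
    case True
    then have "exp (\<alpha> * (1 + real (Y' \<omega>))) \<le> c \<omega>" using \<alpha> by (simp add: c_def)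
    then have "exp (\<alpha> * (1 + real (Y' \<omega>))) * g (Suc (Z \<omega>)) \<le> c \<omega> * g (Suc (Z \<omega>))"
      using g(1) by (rule mult_right_mono)
    also have "\<dots> \<le> c \<omega> * (g (Suc (Z \<omega>)) + a\<^sub>1 (Z \<omega>) * indicator U \<omega> + a\<^sub>2 (Z \<omega>) * J \<omega>)"
      using a c by (intro mult_left_mono) (auto simp: J_def)
    finally show ?thesis using True by simp
  next
    case False
    \<comment> \<open>The increment of \<open>n + X n\<close>, at least 1 at a step that is not a
      descent. The extra 1 produces the constant \<open>exp \<beta>\<close>.\<close>
    define s where "s = 1 + (real (Y' \<omega>) - real (Y \<omega>))"
    have s: "0 \<le> s" using False by (simp add: s_def)
    have J: "exp (\<beta> * s) = exp \<beta> * J \<omega>"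
      using False by (simp add: J_def s_def max_def algebra_simps flip: exp_add)
    have "exp (\<alpha> * (1 + real (Y' \<omega>))) = c \<omega> * exp (\<alpha> * s)"
      by (simp add: c_def s_def algebra_simps flip: exp_add)
    also have "\<dots> \<le> c \<omega> * (1 + A * (\<theta> (Z \<omega>) * exp (\<beta> * s) + 1 / \<theta> (Z \<omega>)))"
      unfolding A_def by (intro mult_left_mono exp_le_Young \<alpha> s \<theta> c)
    also have "\<dots> = c \<omega> * (g (Suc (Z \<omega>)) + a\<^sub>1 (Z \<omega>) * indicator U \<omega> + a\<^sub>2 (Z \<omega>) * J \<omega>)"
      using False that by (simp add: U_def a\<^sub>1_def a\<^sub>2_def J algebra_simps)
    finally show ?thesis using False by simp
  qed
  \<comment> \<open>The majorant after the conditional bounds are inserted. Since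
    \<open>exp (- r * m) = \<theta> m * \<theta> m\<close>, one factor cancels against
    \<open>A / \<theta> m\<close>.\<close>
  have drift: "c \<omega> * (g (Suc m) + a\<^sub>1 m * (1 - \<kappa> m) + a\<^sub>2 m * K) \<le> c \<omega> * g m" for \<omega> m
  proof -
    have "A / \<theta> m * (1 - \<kappa> m) \<le> A / \<theta> m * (C * exp (- r * real m))"
      using A \<theta>[of m] \<kappa>(2)[of m] by (intro mult_left_mono) auto
    also have "\<dots> = A * C * \<theta> m"
    proof -
      have "exp (- r * real m) = \<theta> m * \<theta> m"
        by (simp add: \<theta>_def algebra_simps flip: exp_add)
      then show ?thesis using \<theta>[of m] by simp
    qed
    finally have "g (Suc m) + a\<^sub>1 m * (1 - \<kappa> m) + a\<^sub>2 m * K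
      \<le> g (Suc m) + (1 - g (Suc m)) * (1 - \<kappa> m) + A * (exp \<beta> * K + C) * \<theta> m"
      by (simp add: a\<^sub>1_def a\<^sub>2_def algebra_simps)
    also have "\<dots> \<le> g m"
      using g(3)[of m] by (simp add: A_def \<theta>_def mult.assoc)
    finally show ?thesis using c by (rule mult_left_mono)
  qed

  \<comment> \<open>The coefficients, restricted to \<open>D\<close>. Being measurable for
    \<open>F\<close>, \<open>?b\<^sub>1\<close> and \<open>?b\<^sub>2\<close> allow their partners
    to be replaced by conditional expectations under the integral.\<close>
  let ?b\<^sub>0 = "\<lambda>\<omega>. indicator D \<omega> * ennreal (c \<omega> * g (Suc (Z \<omega>)))"
  let ?b\<^sub>1 = "\<lambda>\<omega>. indicator D \<omega> * ennreal (c \<omega> * a\<^sub>1 (Z \<omega>))"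
  let ?b\<^sub>2 = "\<lambda>\<omega>. indicator D \<omega> * ennreal (c \<omega> * a\<^sub>2 (Z \<omega>))"
  have [measurable]: "?b\<^sub>1 \<in> borel_measurable F" "?b\<^sub>2 \<in> borel_measurable F" by measurable
  have [measurable]: "?b\<^sub>0 \<in> borel_measurable M" "?b\<^sub>1 \<in> borel_measurable M" "?b\<^sub>2 \<in> borel_measurable M"
    by measurable
  have "(\<integral>\<^sup>+\<omega>\<in>D. ennreal (exp (\<alpha> * (1 + real (Y' \<omega>)))
        * (if Y' \<omega> < Y \<omega> then g (Suc (Z \<omega>)) else 1)) \<partial>M)
    \<le> (\<integral>\<^sup>+\<omega>. ?b\<^sub>0 \<omega> + ?b\<^sub>1 \<omega> * indicator U \<omega> + ?b\<^sub>2 \<omega> * ennreal (J \<omega>) \<partial>M)"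
  proof (rule nn_integral_mono)
    fix \<omega> assume "\<omega> \<in> space M"
    have "ennreal (c \<omega> * (g (Suc (Z \<omega>)) + a\<^sub>1 (Z \<omega>) * indicator U \<omega> + a\<^sub>2 (Z \<omega>) * J \<omega>))
      = ennreal (c \<omega> * g (Suc (Z \<omega>))) + ennreal (c \<omega> * a\<^sub>1 (Z \<omega>)) * indicator U \<omega>
        + ennreal (c \<omega> * a\<^sub>2 (Z \<omega>)) * ennreal (J \<omega>)"
      using a c g(1) by (simp add: distrib_left J_def ennreal_plus ennreal_mult'
          flip: ennreal_indicator mult.assoc)
    with ennreal_leI[OF le[OF \<open>\<omega> \<in> space M\<close>]]
    show "ennreal (exp (\<alpha> * (1 + real (Y' \<omega>))) * (if Y' \<omega> < Y \<omega> then g (Suc (Z \<omega>)) else 1))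
        * indicator D \<omega> \<le> ?b\<^sub>0 \<omega> + ?b\<^sub>1 \<omega> * indicator U \<omega> + ?b\<^sub>2 \<omega> * ennreal (J \<omega>)"
      by (cases "\<omega> \<in> D") auto
  qed
  also have "\<dots> = (\<integral>\<^sup>+\<omega>. ?b\<^sub>0 \<omega> \<partial>M) + (\<integral>\<^sup>+\<omega>. ?b\<^sub>1 \<omega> * indicator U \<omega> \<partial>M)
      + (\<integral>\<^sup>+\<omega>. ?b\<^sub>2 \<omega> * ennreal (J \<omega>) \<partial>M)"
    by (simp add: nn_integral_add)
  also have "(\<integral>\<^sup>+\<omega>. ?b\<^sub>1 \<omega> * indicator U \<omega> \<partial>M) = (\<integral>\<^sup>+\<omega>. ?b\<^sub>1 \<omega> * nn_cond_exp M F (indicator U) \<omega> \<partial>M)"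
    by (rule nn_cond_exp_intg[symmetric]) auto
  also have "(\<integral>\<^sup>+\<omega>. ?b\<^sub>2 \<omega> * ennreal (J \<omega>) \<partial>M)
      = (\<integral>\<^sup>+\<omega>. ?b\<^sub>2 \<omega> * nn_cond_exp M F (\<lambda>\<omega>. ennreal (J \<omega>)) \<omega> \<partial>M)"
    by (rule nn_cond_exp_intg[symmetric]) auto
  also have "(\<integral>\<^sup>+\<omega>. ?b\<^sub>0 \<omega> \<partial>M) + (\<integral>\<^sup>+\<omega>. ?b\<^sub>1 \<omega> * nn_cond_exp M F (indicator U) \<omega> \<partial>M)
      + (\<integral>\<^sup>+\<omega>. ?b\<^sub>2 \<omega> * nn_cond_exp M F (\<lambda>\<omega>. ennreal (J \<omega>)) \<omega> \<partial>M)
    = (\<integral>\<^sup>+\<omega>. ?b\<^sub>0 \<omega> + ?b\<^sub>1 \<omega> * nn_cond_exp M F (indicator U) \<omega>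
        + ?b\<^sub>2 \<omega> * nn_cond_exp M F (\<lambda>\<omega>. ennreal (J \<omega>)) \<omega> \<partial>M)"
    by (simp add: nn_integral_add)
  also have "\<dots> \<le> (\<integral>\<^sup>+\<omega>\<in>D. ennreal (c \<omega> * g (Z \<omega>)) \<partial>M)"
  proof (rule nn_integral_mono_AE)
    show "AE \<omega> in M. ?b\<^sub>0 \<omega> + ?b\<^sub>1 \<omega> * nn_cond_exp M F (indicator U) \<omega>
        + ?b\<^sub>2 \<omega> * nn_cond_exp M F (\<lambda>\<omega>. ennreal (J \<omega>)) \<omega> \<le> ennreal (c \<omega> * g (Z \<omega>)) * indicator D \<omega>"
      using fail jump
    proof eventually_elim
      case (elim \<omega>)
      show ?case
      proof (cases "\<omega> \<in> D")
        case True
        let ?m = "Z \<omega>"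
        have "ennreal (c \<omega> * g (Suc ?m)) + ennreal (c \<omega> * a\<^sub>1 ?m) * nn_cond_exp M F (indicator U) \<omega>
            + ennreal (c \<omega> * a\<^sub>2 ?m) * nn_cond_exp M F (\<lambda>\<omega>. ennreal (J \<omega>)) \<omega>
          \<le> ennreal (c \<omega> * g (Suc ?m)) + ennreal (c \<omega> * a\<^sub>1 ?m) * ennreal (1 - \<kappa> ?m)
            + ennreal (c \<omega> * a\<^sub>2 ?m) * ennreal K"
          using elim True by (intro add_mono mult_left_mono order_refl) (auto simp: U_def J_def)
        also have "\<dots> = ennreal (c \<omega> * (g (Suc ?m) + a\<^sub>1 ?m * (1 - \<kappa> ?m) + a\<^sub>2 ?m * K))"
          using a c g(1) K \<kappa>(1) by (simp add: distrib_left ennreal_plus ennreal_mult' flip: mult.assoc)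
        also have "\<dots> \<le> ennreal (c \<omega> * g ?m)" using drift by (rule ennreal_leI)
        finally show ?thesis using True by simp
      qed simp
    qed
  qed
  finally show ?thesis by (simp add: c_def)
qed

subsection \<open>The stopped process\<close>

text \<open>The minimum of \<open>n\<close> and the hitting time of \<open>{0..N}\<close>.\<close>

definition stopped_time :: "(nat \<Rightarrow> 'a \<Rightarrow> nat) \<Rightarrow> nat \<Rightarrow> nat \<Rightarrow> 'a \<Rightarrow> nat" where
  "stopped_time X N n \<omega> = (LEAST t. n \<le> t \<or> X t \<omega> \<le> N)"

lemma stopped_time_le: "stopped_time X N n \<omega> \<le> n"
  unfolding stopped_time_def by (rule Least_le) simp

lemma stopped_time_alive:
  assumes "\<forall>t<n. N < X t \<omega>"
  shows "stopped_time X N n \<omega> = n"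
  unfolding stopped_time_def using assms by (intro Least_equality) (auto simp: not_less[symmetric])

lemma stopped_time_first_hit:
  assumes "X k \<omega> \<le> N" "\<forall>t<k. N < X t \<omega>"
  shows "stopped_time X N n \<omega> = min k n"
  unfolding stopped_time_def
  using assms by (intro Least_equality) (auto simp: min_def not_less[symmetric])

lemma stopped_time_cases:
  fixes X :: "nat \<Rightarrow> 'a \<Rightarrow> nat" and N :: nat
  obtains "\<forall>t. N < X t \<omega>" | k where "X k \<omega> \<le> N" "\<forall>t<k. N < X t \<omega>"
proof (cases "\<forall>t. N < X t \<omega>")
  case False
  then obtain t where "X t \<omega> \<le> N" by (metis leI)
  then have "X (LEAST t. X t \<omega> \<le> N) \<omega> \<le> N" by (rule LeastI)
  moreover have "\<forall>t<(LEAST t. X t \<omega> \<le> N). N < X t \<omega>"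
    by (auto dest: not_less_Least simp: not_le)
  ultimately show ?thesis by (rule that(2))
qed (rule that(1))

text \<open>Prepares monotone convergence: bounds for the stopped times pass to \<tau>. On paths
  that never hit, both sides are infinite.\<close>

lemma exp_hitting_time_eq_SUP:
  assumes "0 < \<alpha>"
  shows "exp_enat \<alpha> (hitting_time X N \<omega>) = (SUP n. ennreal (exp (\<alpha> * real (stopped_time X N n \<omega>))))"
proof (cases rule: stopped_time_cases[where N = N and X = X and \<omega> = \<omega>])
  case 1
  then have *: "{t. X t \<omega> \<le> N} = {}" by (auto simp: not_le)
  have SUP: "(SUP n. ennreal (exp (\<alpha> * real n))) = top"
  proof (rule SUP_eq_top_iff[THEN iffD2], intro allI impI)
    fix x :: ennreal assume "x < top"
    then obtain c where c: "x = ennreal c" "0 \<le> c" by (cases x) auto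
    obtain n where "c < real n * \<alpha>" using reals_Archimedean3[OF assms] by blast
    also have "\<dots> < exp (\<alpha> * real n)"
      using exp_ge_add_one_self[of "\<alpha> * real n"] by (simp only: mult.commute[of _ \<alpha>]; linarith)
    finally show "\<exists>i\<in>UNIV. x < ennreal (exp (\<alpha> * real i))"
      using c by (auto intro!: exI[of _ n] simp: ennreal_less_iff)
  qed
  then show ?thesis
    using 1 by (simp add: hitting_time_def exp_enat_def * stopped_time_alive SUP top_enat_def)
next
  case (2 k)
  have "hitting_time X N \<omega> = enat k"
    unfolding hitting_time_def
  proof (rule antisym)
    show "(INF t\<in>{t. X t \<omega> \<le> N}. enat t) \<le> enat k" using 2 by (intro INF_lower) simp
    show "enat k \<le> (INF t\<in>{t. X t \<omega> \<le> N}. enat t)"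
      using 2 by (intro INF_greatest) (auto simp: not_less[symmetric])
  qed
  moreover have "(SUP n. ennreal (exp (\<alpha> * real (min k n)))) = ennreal (exp (\<alpha> * real k))"
  proof (rule antisym)
    show "(SUP n. ennreal (exp (\<alpha> * real (min k n)))) \<le> ennreal (exp (\<alpha> * real k))"
      using assms by (intro SUP_least ennreal_leI) simp
    show "ennreal (exp (\<alpha> * real k)) \<le> (SUP n. ennreal (exp (\<alpha> * real (min k n))))"
      by (rule SUP_upper2[of k]) auto
  qed
  ultimately show ?thesis
    using 2 by (simp add: exp_enat_def stopped_time_first_hit)
qed

section \<open>One-step bounds under the natural filtration and the supermartingale argument\<close>

context
  fixes M :: "'a measure" and X :: "nat \<Rightarrow> 'a \<Rightarrow> nat" and N :: nat and \<kappa> :: "nat \<Rightarrow> real"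
  assumes M: "prob_space M"
    and X: "\<And>n. X n \<in> measurable M (count_space UNIV)"
    and A1: "\<And>n j. AE \<omega> in M.
          prob_given M (natural_filtration M X n) (\<lambda>\<omega>. X (n + 1) \<omega> = j) \<omega> =
          prob_given M (stretch_sigma M X n) (\<lambda>\<omega>. X (n + 1) \<omega> = j) \<omega>"
begin

lemma subalgebra_stretch_sigma_space: "subalgebra M (stretch_sigma M X n)"
  using subalgebra_natural_filtration[where X = X and n = n, OF X]
    subalgebra_stretch_sigma[where X = X and n = n, OF X]
  by (auto simp: subalgebra_def)

lemma nn_cond_exp_natural_filtration:
  assumes "\<And>j. f j \<in> borel_measurable (stretch_sigma M X n)"
  shows "AE \<omega> in M. nn_cond_exp M (natural_filtration M X n) (\<lambda>\<omega>. f (X (Suc n) \<omega>) \<omega>) \<omega>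
    = nn_cond_exp M (stretch_sigma M X n) (\<lambda>\<omega>. f (X (Suc n) \<omega>) \<omega>) \<omega>"
proof (rule nn_cond_exp_eq_of_nat_valued)
  show fin: "finite_measure M" using M by (rule prob_space.finite_measure)
  fix j
  have [measurable]: "{\<omega> \<in> space M. X (Suc n) \<omega> = j} \<in> sets M"
    using X[of "Suc n"] by measurable
  note eq = ennreal_real_cond_exp_indicator[OF fin _ this]
  show "AE \<omega> in M. nn_cond_exp M (natural_filtration M X n)
      (indicator {\<omega> \<in> space M. X (Suc n) \<omega> = j}) \<omega>
    = nn_cond_exp M (stretch_sigma M X n) (indicator {\<omega> \<in> space M. X (Suc n) \<omega> = j}) \<omega>"
    using A1[of n j] eq[OF subalgebra_natural_filtration[where X = X and n = n, OF X]]
      eq[OF subalgebra_stretch_sigma_space[of n]]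
    by eventually_elim (simp add: prob_given_def)
qed (use assms X subalgebra_natural_filtration[where X = X, OF X] subalgebra_stretch_sigma[where X = X, OF X] in auto)

text \<open>(A3) speaks of a fixed depth, while the length of the stretch is random but at most
  \<open>n\<close>. The countably many exceptional null sets are united, and then the depth
  \<open>k = n - stretch_start X n \<omega>\<close> is chosen separately at each \<omega>.\<close>

lemma nn_cond_exp_no_descent_le:
  assumes A3: "\<And>m n. m \<ge> 1 \<Longrightarrow> n \<ge> m - 1 \<Longrightarrow> AE \<omega> in M.
          N < X n \<omega> \<and> (\<forall>i\<in>{n - (m - 1)..<n}. X (i + 1) \<omega> < X i \<omega>) \<longrightarrow>
          prob_given M (stretch_sigma M X n) (\<lambda>\<omega>. X (n + 1) \<omega> < X n \<omega>) \<omega> \<ge> \<kappa> (m - 1)"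
    and \<kappa>: "\<And>m. 0 < \<kappa> m"
  shows "AE \<omega> in M. N < X n \<omega> \<longrightarrow> nn_cond_exp M (natural_filtration M X n)
    (indicator {\<omega> \<in> space M. \<not> X (Suc n) \<omega> < X n \<omega>}) \<omega>
      \<le> ennreal (1 - \<kappa> (n - stretch_start X n \<omega>))"
proof -
  let ?A = "{\<omega> \<in> space M. X (Suc n) \<omega> < X n \<omega>}"
  let ?f = "\<lambda>j. indicator {\<omega> \<in> space M. \<not> j < X n \<omega>} :: 'a \<Rightarrow> ennreal"
  have [measurable]: "X n \<in> borel_measurable (stretch_sigma M X n)"
    by (intro borel_measurable_count_space_nat measurable_stretch_sigma_last X)
  have [measurable]: "X n \<in> borel_measurable M" "X (Suc n) \<in> borel_measurable M"
    by (auto intro: borel_measurable_count_space_nat X)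
  have compl: "space M - ?A = {\<omega> \<in> space M. \<not> X (Suc n) \<omega> < X n \<omega>}" by auto
  have "{\<omega> \<in> space M. \<not> j < X n \<omega>} \<in> sets (stretch_sigma M X n)" for j
  proof -
    have "space (stretch_sigma M X n) = space M"
      using subalgebra_stretch_sigma_space by (simp add: subalgebra_def)
    moreover have "{\<omega> \<in> space (stretch_sigma M X n). \<not> j < X n \<omega>} \<in> sets (stretch_sigma M X n)"
      by measurable
    ultimately show ?thesis by simp
  qed
  then have "AE \<omega> in M. nn_cond_exp M (natural_filtration M X n) (\<lambda>\<omega>. ?f (X (Suc n) \<omega>) \<omega>) \<omega>
      = nn_cond_exp M (stretch_sigma M X n) (\<lambda>\<omega>. ?f (X (Suc n) \<omega>) \<omega>) \<omega>"
    by (intro nn_cond_exp_natural_filtration) auto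
  \<comment> \<open>Failure to descend is a function of the next state whose parameter
    \<open>X n\<close> is known from the stretch, so the transfer from (A1) applies.\<close>
  moreover have f: "(\<lambda>\<omega>. ?f (X (Suc n) \<omega>) \<omega>) = indicator {\<omega> \<in> space M. \<not> X (Suc n) \<omega> < X n \<omega>}"
    by (auto simp: fun_eq_iff indicator_def)
  ultimately have "AE \<omega> in M. nn_cond_exp M (natural_filtration M X n) (indicator (space M - ?A)) \<omega>
      = nn_cond_exp M (stretch_sigma M X n) (indicator (space M - ?A)) \<omega>"
    by (simp only: f compl)
  moreover have "AE \<omega> in M. \<forall>k. k \<le> n \<longrightarrow>
      N < X n \<omega> \<and> (\<forall>i\<in>{n - k..<n}. X (i + 1) \<omega> < X i \<omega>) \<longrightarrow>
      nn_cond_exp M (stretch_sigma M X n) (indicator (space M - ?A)) \<omega> \<le> ennreal (1 - \<kappa> k)"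
  proof (subst AE_all_countable, rule allI)
    fix k
    show "AE \<omega> in M. k \<le> n \<longrightarrow>
      N < X n \<omega> \<and> (\<forall>i\<in>{n - k..<n}. X (i + 1) \<omega> < X i \<omega>) \<longrightarrow>
      nn_cond_exp M (stretch_sigma M X n) (indicator (space M - ?A)) \<omega> \<le> ennreal (1 - \<kappa> k)"
    proof (cases "k \<le> n")
      case True
      have "AE \<omega> in M. N < X n \<omega> \<and> (\<forall>i\<in>{n - k..<n}. X (i + 1) \<omega> < X i \<omega>) \<longrightarrow>
          \<kappa> k \<le> real_cond_exp M (stretch_sigma M X n) (indicator ?A) \<omega>"
        \<comment> \<open>Depth \<open>k\<close> means \<open>k\<close> past descents, hence
          \<open>m = k + 1\<close> in (A3).\<close>
        using A3[of "Suc k" n] True by (simp add: prob_given_def)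
      then have "AE \<omega> in M. N < X n \<omega> \<and> (\<forall>i\<in>{n - k..<n}. X (i + 1) \<omega> < X i \<omega>) \<longrightarrow>
          nn_cond_exp M (stretch_sigma M X n) (indicator (space M - ?A)) \<omega> \<le> ennreal (1 - \<kappa> k)"
        by (intro nn_cond_exp_compl_le subalgebra_stretch_sigma_space prob_space.finite_measure M
            less_imp_le[OF \<kappa>]) auto
      then show ?thesis by eventually_elim blast
    qed simp
  qed
  ultimately show ?thesis
    unfolding compl
  proof eventually_elim
    case (elim \<omega>)
    have "n - stretch_start X n \<omega> \<le> n"
      "\<forall>i\<in>{n - (n - stretch_start X n \<omega>)..<n}. X (i + 1) \<omega> < X i \<omega>"
      using stretch_start_le[of X n \<omega>] stretch_start_decreasing[of X n \<omega>] by auto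
    with elim show ?case by (metis (no_types, lifting))
  qed
qed

lemma nn_cond_exp_jump_le:
  assumes "jump_exp_moment M X \<beta> = ennreal K"
  shows "AE \<omega> in M. nn_cond_exp M (natural_filtration M X n)
    (\<lambda>\<omega>. ennreal (exp (\<beta> * max (real (X (Suc n) \<omega>) - real (X n \<omega>)) 0))) \<omega> \<le> ennreal K"
proof -
  let ?J = "\<lambda>n \<omega>. ennreal (exp (\<beta> * max (real (X (Suc n) \<omega>) - real (X n \<omega>)) 0))"
  have [measurable]: "X n \<in> measurable (stretch_sigma M X n) (count_space UNIV)"
    by (intro measurable_stretch_sigma_last X)
  have "AE \<omega> in M. nn_cond_exp M (natural_filtration M X n) (?J n) \<omega>
      = nn_cond_exp M (stretch_sigma M X n) (?J n) \<omega>"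
    by (rule nn_cond_exp_natural_filtration
        [where f = "\<lambda>j \<omega>. ennreal (exp (\<beta> * max (real j - real (X n \<omega>)) 0))"]) measurable
  moreover have "AE \<omega> in M. (SUP n. nn_cond_exp M (stretch_sigma M X n) (?J n) \<omega>)
      \<le> jump_exp_moment M X \<beta>"
    unfolding jump_exp_moment_def Suc_eq_plus1 by (rule esssup_AE)
  ultimately show ?thesis
  proof eventually_elim
    case (elim \<omega>)
    have "nn_cond_exp M (stretch_sigma M X n) (?J n) \<omega>
        \<le> (SUP n. nn_cond_exp M (stretch_sigma M X n) (?J n) \<omega>)"
      by (rule SUP_upper) simp
    with elim show ?case using assms by auto
  qed
qed

text \<open>\<open>step\<close> makes \<open>Y\<close> decrease in mean on the starting event. As
  \<open>Y n\<close> is at least half of \<open>exp (\<alpha> * T n)\<close>, the bound at time 0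
  costs only a factor 2.\<close>

lemma exp_hitting_time_le:
  fixes g :: "nat \<Rightarrow> real"
  assumes "0 < \<alpha>" and g0: "g 0 = 1" and g: "\<And>m. 1 / 2 \<le> g m"
    and step: "\<And>n D. D \<in> sets (natural_filtration M X n) \<Longrightarrow> D \<subseteq> {\<omega>. N < X n \<omega>} \<Longrightarrow>
      (\<integral>\<^sup>+\<omega>\<in>D. ennreal (exp (\<alpha> * (1 + real (X (Suc n) \<omega>))) *
          g (Suc n - stretch_start X (Suc n) \<omega>)) \<partial>M)
      \<le> (\<integral>\<^sup>+\<omega>\<in>D. ennreal (exp (\<alpha> * real (X n \<omega>)) * g (n - stretch_start X n \<omega>)) \<partial>M)"
    and v: "measure M {\<omega> \<in> space M. X 0 \<omega> = v} > 0"
  shows "(\<integral>\<^sup>+ \<omega>. exp_enat \<alpha> (hitting_time X N \<omega>) \<partial>start_measure M X v)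
    \<le> ennreal (2 * exp (\<alpha> * real v))"
proof -
  interpret prob_space M by (rule M)
  define S where "S = {\<omega> \<in> space M. X 0 \<omega> = v}"
  define T where "T = stopped_time X N"
  define D where "D n = {\<omega> \<in> space M. X 0 \<omega> = v \<and> (\<forall>t\<le>n. N < X t \<omega>)}" for n
  define V where "V n \<omega> = exp (\<alpha> * real (X n \<omega>)) * g (n - stretch_start X n \<omega>)" for n \<omega>
  \<comment> \<open>After the hit, \<open>V\<close> is replaced by its lower bound
    \<open>1 / 2\<close>: the replacement cannot increase \<open>Y\<close>, and from then on
    \<open>Y\<close> is frozen.\<close>
  define Y where "Y n \<omega> = exp (\<alpha> * real (T n \<omega>)) * (if \<forall>t\<le>n. N < X t \<omega> then V n \<omega> else 1 / 2)" for n \<omega>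
  note X [measurable]
  have [measurable]: "S \<in> sets M" unfolding S_def by measurable
  have [measurable]: "T n \<in> measurable M (count_space UNIV)" for n
    unfolding T_def stopped_time_def [abs_def] by measurable
  have [measurable]: "stretch_start X n \<in> measurable M (count_space UNIV)" for n
    by (rule measurable_stretch_start) (rule X)
  have [measurable]: "V n \<in> borel_measurable M" for n unfolding V_def [abs_def] by measurable
  have [measurable]: "Y n \<in> borel_measurable M" for n unfolding Y_def [abs_def] by measurable
  have DF: "D n \<in> sets (natural_filtration M X n)" for n
  proof -
    have space: "space (natural_filtration M X n) = space M"
      using subalgebra_natural_filtration[where X = X and n = n, OF X] by (simp add: subalgebra_def)
    have sets: "X t -` A \<inter> space M \<in> sets (natural_filtration M X n)" if "t \<le> n" for t A
      using measurable_sets[OF measurable_natural_filtration[where X = X, OF X that], of A]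
      by (simp add: space)
    have "D n = (X 0 -` {v} \<inter> space M) \<inter> (\<Inter>t\<in>{..n}. X t -` {N<..} \<inter> space M)"
      by (auto simp: D_def)
    moreover have "(X 0 -` {v} \<inter> space M) \<inter> (\<Inter>t\<in>{..n}. X t -` {N<..} \<inter> space M)
        \<in> sets (natural_filtration M X n)"
      by (intro sets.Int sets.finite_INT sets) auto
    ultimately show ?thesis by simp
  qed
  have DM [measurable]: "D n \<in> sets M" for n
    using DF[of n] subalgebra_natural_filtration[where X = X and n = n, OF X] by (auto simp: subalgebra_def)
  have V_ge: "1 / 2 \<le> V n \<omega>" for n \<omega>
  proof -
    have "1 * (1 / 2) \<le> V n \<omega>" unfolding V_def using g \<open>0 < \<alpha>\<close> by (intro mult_mono) auto
    then show ?thesis by simp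
  qed
  have Y_decr: "(\<integral>\<^sup>+\<omega>\<in>S. ennreal (Y (Suc n) \<omega>) \<partial>M) \<le> (\<integral>\<^sup>+\<omega>\<in>S. ennreal (Y n \<omega>) \<partial>M)" for n
  proof -
    let ?c = "ennreal (exp (\<alpha> * real n))"
    let ?V' = "\<lambda>\<omega>. exp (\<alpha> * (1 + real (X (Suc n) \<omega>))) * g (Suc n - stretch_start X (Suc n) \<omega>)"
    have "(\<integral>\<^sup>+\<omega>\<in>S. ennreal (Y (Suc n) \<omega>) \<partial>M)
      \<le> (\<integral>\<^sup>+\<omega>. ennreal (Y n \<omega>) * indicator (S - D n) \<omega> + ?c * (ennreal (?V' \<omega>) * indicator (D n) \<omega>) \<partial>M)"
    proof (rule nn_integral_mono)
      fix \<omega> assume \<omega>: "\<omega> \<in> space M"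
      consider "\<omega> \<notin> S" | "\<omega> \<in> D n" | "\<omega> \<in> S - D n" by auto
      then show "ennreal (Y (Suc n) \<omega>) * indicator S \<omega>
        \<le> ennreal (Y n \<omega>) * indicator (S - D n) \<omega> + ?c * (ennreal (?V' \<omega>) * indicator (D n) \<omega>)"
      proof cases
        case 2
        then have alive: "\<forall>t\<le>n. N < X t \<omega>" by (simp add: D_def)
        then have T: "T (Suc n) \<omega> = Suc n"
          unfolding T_def by (intro stopped_time_alive) auto
        \<comment> \<open>Either the process is still above \<open>N\<close> at time
          \<open>Suc n\<close> and equality holds, or it has just hit and \<open>V_ge\<close>
          applies. The stopped time is \<open>Suc n\<close> in both cases.\<close>
        have "Y (Suc n) \<omega> \<le> exp (\<alpha> * real (T (Suc n) \<omega>)) * V (Suc n) \<omega>"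
          using V_ge[of "Suc n" \<omega>] by (auto simp: Y_def)
        also have "\<dots> = exp (\<alpha> * real n) * ?V' \<omega>"
          by (simp add: V_def T algebra_simps flip: exp_add)
        finally have "ennreal (Y (Suc n) \<omega>) \<le> ?c * ennreal (?V' \<omega>)"
          by (simp add: ennreal_leI flip: ennreal_mult')
        with 2 show ?thesis by (simp add: D_def S_def indicator_def)
      next
        case 3
        then have "\<not> (\<forall>t\<le>n. N < X t \<omega>)" using \<omega> by (simp add: D_def S_def)
        then obtain t where t: "t \<le> n" "X t \<omega> \<le> N" by (metis leI)
        have "T (Suc n) \<omega> = T n \<omega>"
        proof (cases rule: stopped_time_cases[where N = N and X = X and \<omega> = \<omega>])
          case (2 k)
          then have "k \<le> n" using t by (metis leI le_trans not_less)
          then show ?thesis unfolding T_def using stopped_time_first_hit[of X k \<omega> N] 2 by simp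
        qed (use t in \<open>simp add: not_less[symmetric]\<close>)
        then have "Y (Suc n) \<omega> = Y n \<omega>"
          using \<open>\<not> (\<forall>t\<le>n. N < X t \<omega>)\<close> by (auto simp: Y_def le_Suc_eq)
        with 3 show ?thesis by simp
      qed simp
    qed
    also have "\<dots> = (\<integral>\<^sup>+\<omega>. ennreal (Y n \<omega>) * indicator (S - D n) \<omega> \<partial>M)
        + ?c * (\<integral>\<^sup>+\<omega>\<in>D n. ennreal (?V' \<omega>) \<partial>M)"
      by (subst nn_integral_add) (auto intro!: arg_cong2[where f = "(+)"] nn_integral_cmult)
    also have "\<dots> \<le> (\<integral>\<^sup>+\<omega>. ennreal (Y n \<omega>) * indicator (S - D n) \<omega> \<partial>M)
        + ?c * (\<integral>\<^sup>+\<omega>\<in>D n. ennreal (V n \<omega>) \<partial>M)"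
      unfolding V_def by (intro add_left_mono mult_left_mono step DF) (auto simp: D_def)
    also have "\<dots> = (\<integral>\<^sup>+\<omega>. ennreal (Y n \<omega>) * indicator (S - D n) \<omega>
        + ?c * (ennreal (V n \<omega>) * indicator (D n) \<omega>) \<partial>M)"
      by (subst nn_integral_add) (auto intro!: arg_cong2[where f = "(+)"] nn_integral_cmult[symmetric])
    also have "\<dots> = (\<integral>\<^sup>+\<omega>\<in>S. ennreal (Y n \<omega>) \<partial>M)"
    proof (rule nn_integral_cong)
      fix \<omega> assume \<omega>: "\<omega> \<in> space M"
      show "ennreal (Y n \<omega>) * indicator (S - D n) \<omega> + ?c * (ennreal (V n \<omega>) * indicator (D n) \<omega>)
        = ennreal (Y n \<omega>) * indicator S \<omega>"
      proof (cases "\<omega> \<in> D n")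
        case True
        then have "Y n \<omega> = exp (\<alpha> * real n) * V n \<omega>" "\<omega> \<in> S"
          using stopped_time_alive[of n N X \<omega>] by (auto simp: Y_def D_def S_def T_def)
        with True show ?thesis by (simp add: ennreal_mult')
      qed (auto simp: indicator_def)
    qed
    finally show ?thesis .
  qed
  have Y0: "(\<integral>\<^sup>+\<omega>\<in>S. ennreal (Y 0 \<omega>) \<partial>M) \<le> ennreal (exp (\<alpha> * real v)) * emeasure M S"
  proof -
    have "(\<integral>\<^sup>+\<omega>\<in>S. ennreal (Y 0 \<omega>) \<partial>M) \<le> (\<integral>\<^sup>+\<omega>. ennreal (exp (\<alpha> * real v)) * indicator S \<omega> \<partial>M)"
    proof (rule nn_integral_mono)
      fix \<omega>
      \<comment> \<open>The initial stretch has length 0, so the weight is \<open>g 0 = 1\<close>; a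
        start at or below \<open>N\<close> gives just \<open>1 / 2\<close>.\<close>
      have "Y 0 \<omega> \<le> exp (\<alpha> * real v)" if "\<omega> \<in> S"
      proof -
        have "T 0 \<omega> = 0" using stopped_time_le[of X N 0 \<omega>] by (simp add: T_def)
        moreover have "1 \<le> exp (\<alpha> * real v)" using \<open>0 < \<alpha>\<close> by simp
        then have "1 / 2 \<le> exp (\<alpha> * real v)" by linarith
        moreover have "V 0 \<omega> = exp (\<alpha> * real v)"
          using that g0 by (simp add: V_def S_def)
        ultimately show ?thesis by (simp add: Y_def)
      qed
      then show "ennreal (Y 0 \<omega>) * indicator S \<omega> \<le> ennreal (exp (\<alpha> * real v)) * indicator S \<omega>"
        by (cases "\<omega> \<in> S") (auto intro: ennreal_leI)
    qed
    then show ?thesis by (simp add: nn_integral_cmult_indicator)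
  qed
  have Y_le: "(\<integral>\<^sup>+\<omega>\<in>S. ennreal (Y n \<omega>) \<partial>M) \<le> ennreal (exp (\<alpha> * real v)) * emeasure M S" for n
    by (induction n) (rule Y0, rule order_trans[OF Y_decr])
  have T_le: "(\<integral>\<^sup>+\<omega>\<in>S. ennreal (exp (\<alpha> * real (T n \<omega>))) \<partial>M)
    \<le> ennreal (2 * exp (\<alpha> * real v)) * emeasure M S" for n
  proof -
    have "(\<integral>\<^sup>+\<omega>\<in>S. ennreal (exp (\<alpha> * real (T n \<omega>))) \<partial>M) \<le> (\<integral>\<^sup>+\<omega>. 2 * (ennreal (Y n \<omega>) * indicator S \<omega>) \<partial>M)"
    proof (rule nn_integral_mono)
      fix \<omega>
      have "exp (\<alpha> * real (T n \<omega>)) * (1 / 2) \<le> Y n \<omega>"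
        unfolding Y_def using V_ge by (intro mult_left_mono) auto
      then have "ennreal (exp (\<alpha> * real (T n \<omega>))) \<le> ennreal (2 * Y n \<omega>)"
        by (intro ennreal_leI) simp
      also have "\<dots> = 2 * ennreal (Y n \<omega>)" by (simp add: ennreal_mult')
      finally show "ennreal (exp (\<alpha> * real (T n \<omega>))) * indicator S \<omega>
          \<le> 2 * (ennreal (Y n \<omega>) * indicator S \<omega>)"
        by (cases "\<omega> \<in> S") auto
    qed
    also have "\<dots> = 2 * (\<integral>\<^sup>+\<omega>\<in>S. ennreal (Y n \<omega>) \<partial>M)" by (rule nn_integral_cmult) measurable
    also have "\<dots> \<le> 2 * (ennreal (exp (\<alpha> * real v)) * emeasure M S)"
      using Y_le by (rule mult_left_mono) simp
    also have "\<dots> = ennreal (2 * exp (\<alpha> * real v)) * emeasure M S"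
      by (simp add: ennreal_mult' mult.assoc)
    finally show ?thesis .
  qed
  have T_mono: "T n \<omega> \<le> T (Suc n) \<omega>" for n \<omega>
  proof (cases rule: stopped_time_cases[where N = N and X = X and \<omega> = \<omega>])
    case 1
    then show ?thesis by (simp add: T_def stopped_time_alive)
  next
    case (2 k)
    then show ?thesis unfolding T_def by (subst (1 2) stopped_time_first_hit[of X k]) auto
  qed
  have "(\<integral>\<^sup>+ \<omega>. exp_enat \<alpha> (hitting_time X N \<omega>) \<partial>start_measure M X v)
    = (\<integral>\<^sup>+\<omega>\<in>S. (SUP n. ennreal (exp (\<alpha> * real (T n \<omega>)))) \<partial>M) / emeasure M S"
    unfolding start_measure_def exp_hitting_time_eq_SUP[OF \<open>0 < \<alpha>\<close>] T_def[symmetric] S_def[symmetric]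
    by (rule nn_integral_uniform_measure) measurable
  also have "(\<integral>\<^sup>+\<omega>\<in>S. (SUP n. ennreal (exp (\<alpha> * real (T n \<omega>)))) \<partial>M)
    = (\<integral>\<^sup>+\<omega>. (SUP n. ennreal (exp (\<alpha> * real (T n \<omega>))) * indicator S \<omega>) \<partial>M)"
    by (simp add: SUP_mult_right_ennreal)
  also have "\<dots> = (SUP n. \<integral>\<^sup>+\<omega>\<in>S. ennreal (exp (\<alpha> * real (T n \<omega>))) \<partial>M)"
  proof (rule nn_integral_monotone_convergence_SUP)
    show "incseq (\<lambda>n \<omega>. ennreal (exp (\<alpha> * real (T n \<omega>))) * indicator S \<omega>)"
      using T_mono \<open>0 < \<alpha>\<close>
      by (intro incseq_SucI le_funI mult_right_mono ennreal_leI) auto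
  qed measurable
  also have "\<dots> / emeasure M S \<le> ennreal (2 * exp (\<alpha> * real v)) * emeasure M S / emeasure M S"
    using T_le by (intro divide_right_mono_ennreal SUP_least)
  also have "\<dots> = ennreal (2 * exp (\<alpha> * real v))"
    using v by (simp add: emeasure_eq_measure S_def divide_ennreal flip: ennreal_mult')
  finally show ?thesis .
qed

end

section \<open>Choice of the exponents and assembly of the bound\<close>

theorem theorem1:
  fixes M :: "'a measure" and X :: "nat \<Rightarrow> 'a \<Rightarrow> nat" and N :: nat and \<kappa> :: "nat \<Rightarrow> real"
  assumes "prob_space M"
    and "\<And>n. X n \<in> measurable M (count_space UNIV)"
    and "incseq \<kappa>" and "\<And>m. 0 < \<kappa> m" and "\<And>m. \<kappa> m \<le> 1"
    and A1: "\<And>n j. AE \<omega> in M.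
          prob_given M (natural_filtration M X n) (\<lambda>\<omega>. X (n + 1) \<omega> = j) \<omega> =
          prob_given M (stretch_sigma M X n) (\<lambda>\<omega>. X (n + 1) \<omega> = j) \<omega>"
    and A3: "\<And>m n. m \<ge> 1 \<Longrightarrow> n \<ge> m - 1 \<Longrightarrow> AE \<omega> in M.
          N < X n \<omega> \<and> (\<forall>i\<in>{n - (m - 1)..<n}. X (i + 1) \<omega> < X i \<omega>) \<longrightarrow>
          prob_given M (stretch_sigma M X n) (\<lambda>\<omega>. X (n + 1) \<omega> < X n \<omega>) \<omega> \<ge> \<kappa> (m - 1)"
    and A4_rate: "\<exists>C>0. \<exists>r>0. \<forall>m. 1 - \<kappa> m \<le> C * exp (- r * real m)"
    and A4_prod: "convergent_prod \<kappa>" "(\<Prod>i. \<kappa> i) > 0"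
    and A5: "\<forall>\<^sub>F \<alpha> in at_right 0. jump_exp_moment M X \<alpha> < \<infinity>"
  shows "\<forall>\<^sub>F \<alpha> in at_right (0::real). \<exists>C\<^sub>1>0. \<forall>v\<^sub>0.
           measure M {\<omega> \<in> space M. X 0 \<omega> = v\<^sub>0} > 0 \<longrightarrow>
           (\<integral>\<^sup>+ \<omega>. exp_enat \<alpha> (hitting_time X N \<omega>) \<partial>start_measure M X v\<^sub>0)
             \<le> ennreal (C\<^sub>1 * exp (\<alpha> * real v\<^sub>0))"
proof -
  note X [measurable] = assms(2)
  note \<kappa> = assms(4,5)
  obtain C r where C: "0 < C" and r: "0 < r" and rate: "\<And>m. 1 - \<kappa> m \<le> C * exp (- r * real m)"
    using A4_rate by blast
  \<comment> \<open>One exponent \<beta> with finite jump moment is fixed; \<alpha> then ranges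
    below \<open>\<beta> / 4\<close>, as Young's inequality requires.\<close>
  have "\<forall>\<^sub>F \<alpha> in at_right (0::real). 0 < \<alpha> \<and> jump_exp_moment M X \<alpha> < \<infinity>"
    using A5 eventually_at_right_less[of "0::real"] by eventually_elim simp
  then obtain \<beta> where \<beta>: "0 < \<beta>" "jump_exp_moment M X \<beta> < \<infinity>"
    by (metis (mono_tags, lifting) eventually_happens trivial_limit_at_right_real)
  then obtain K where K: "0 \<le> K" "jump_exp_moment M X \<beta> = ennreal K"
    by (cases "jump_exp_moment M X \<beta>") auto
  define L where "L = 2 / \<beta> * (exp \<beta> * K + C)"
  have "0 \<le> L" using \<beta> K C by (simp add: L_def)
  have "\<forall>\<^sub>F \<alpha> in at_right 0. \<alpha> \<in> {0<..<\<beta> / 4}"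
    using \<beta> by (intro eventually_at_right_real) simp
  moreover have "0 < r / 2" using r by simp
  note eventually_stretch_weights[OF \<kappa> A4_prod \<open>0 \<le> L\<close> this]
  ultimately have "\<forall>\<^sub>F \<alpha> in at_right 0. \<alpha> \<in> {0<..<\<beta> / 4} \<and> (\<exists>g :: nat \<Rightarrow> real. g 0 = 1 \<and>
      (\<forall>m. 1 / 2 \<le> g m \<and> g m \<le> 1 \<and>
       g (Suc m) + (1 - g (Suc m)) * (1 - \<kappa> m) + \<alpha> * L * exp (- (r / 2) * real m) \<le> g m))"
    by (rule eventually_conj)
  then show ?thesis
  proof eventually_elim
    case (elim \<alpha>)
    then obtain g :: "nat \<Rightarrow> real" where g0: "g 0 = 1"
      and g: "\<And>m. 1 / 2 \<le> g m" "\<And>m. g m \<le> 1"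
        "\<And>m. g (Suc m) + (1 - g (Suc m)) * (1 - \<kappa> m) + \<alpha> * L * exp (- (r / 2) * real m) \<le> g m"
      by blast
    have g_nonneg: "0 \<le> g m" for m using g(1)[of m] by simp
    have \<alpha>: "0 < \<alpha>" "\<alpha> \<le> \<beta> / 4" using elim by auto
    have step: "(\<integral>\<^sup>+\<omega>\<in>D. ennreal (exp (\<alpha> * (1 + real (X (Suc n) \<omega>))) *
          g (Suc n - stretch_start X (Suc n) \<omega>)) \<partial>M)
      \<le> (\<integral>\<^sup>+\<omega>\<in>D. ennreal (exp (\<alpha> * real (X n \<omega>)) * g (n - stretch_start X n \<omega>)) \<partial>M)"
      if D: "D \<in> sets (natural_filtration M X n)" "D \<subseteq> {\<omega>. N < X n \<omega>}" for n D
    proof -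
      let ?F = "natural_filtration M X n"
      have X_F: "X i \<in> measurable ?F (count_space UNIV)" if "i \<le> n" for i
        using that by (rule measurable_natural_filtration[where X = X, OF X])
      have "stretch_start X n \<in> measurable ?F (count_space UNIV)"
        by (rule measurable_stretch_start[OF X_F])
      then have Z: "(\<lambda>\<omega>. n - stretch_start X n \<omega>) \<in> measurable ?F (count_space UNIV)"
        by measurable
      have "AE \<omega> in M. N < X n \<omega> \<longrightarrow> nn_cond_exp M ?F
          (indicator {\<omega> \<in> space M. \<not> X (Suc n) \<omega> < X n \<omega>}) \<omega>
            \<le> ennreal (1 - \<kappa> (n - stretch_start X n \<omega>))"
        by (rule nn_cond_exp_no_descent_le[OF assms(1) X A1 _ \<kappa>(1)]) (rule A3)
      then have fail: "AE \<omega> in M. \<omega> \<in> D \<longrightarrow> nn_cond_exp M ?F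
          (indicator {\<omega> \<in> space M. \<not> X (Suc n) \<omega> < X n \<omega>}) \<omega>
            \<le> ennreal (1 - \<kappa> (n - stretch_start X n \<omega>))"
        by eventually_elim (use D in auto)
      have jump: "AE \<omega> in M. nn_cond_exp M ?F
          (\<lambda>\<omega>. ennreal (exp (\<beta> * max (real (X (Suc n) \<omega>) - real (X n \<omega>)) 0))) \<omega> \<le> ennreal K"
        by (rule nn_cond_exp_jump_le[OF assms(1) X A1 K(2)])
      have "(\<integral>\<^sup>+\<omega>\<in>D. ennreal (exp (\<alpha> * (1 + real (X (Suc n) \<omega>)))
          * (if X (Suc n) \<omega> < X n \<omega> then g (Suc (n - stretch_start X n \<omega>)) else 1)) \<partial>M)
        \<le> (\<integral>\<^sup>+\<omega>\<in>D. ennreal (exp (\<alpha> * real (X n \<omega>)) * g (n - stretch_start X n \<omega>)) \<partial>M)"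
        by (rule drift_one_step[where Z = "\<lambda>\<omega>. n - stretch_start X n \<omega>", OF assms(1)
              subalgebra_natural_filtration[where X = X, OF X] Z X_F[OF order_refl] X D(1)
              fail jump K(1) \<kappa>(2) rate \<alpha> g_nonneg g(2) g(3)[unfolded L_def]])
      \<comment> \<open>The next stretch length is the successor of the old one after a descent and
        0 otherwise, where \<open>g 0 = 1\<close>.\<close>
      also have "(\<lambda>\<omega>. if X (Suc n) \<omega> < X n \<omega> then g (Suc (n - stretch_start X n \<omega>)) else 1)
        = (\<lambda>\<omega>. g (Suc n - stretch_start X (Suc n) \<omega>))"
        by (auto simp: fun_eq_iff stretch_start_Suc g0 Suc_diff_le stretch_start_le)
      finally show ?thesis .
    qed
    show ?case
      \<comment> \<open>The witness 2 is the inverse of the lower bound \<open>1 / 2\<close> for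
        \<open>g\<close>.\<close>
      using exp_hitting_time_le[OF assms(1) X A1 \<alpha>(1) g0 g(1) step] by (intro exI[of _ 2]) auto
  qed
qed

end
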